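(* Let $X=X_1X_2\cdots X_n$ and $Y=Y_1Y_2\cdots Y_n$ be the first $n$ letters of two independent sequences $\{X_i\}_{i\in\mathbb{N}}$, $\{Y_i\}_{i\in\mathbb{N}}$ of i.i.d. Bernoulli random variables with parameter $1/2$. Let the scoring function satisfy $s(1,0)=s(0,1)=0$, $s(0,0)=1$, with gap penalty $q=0$, and let $L_n$ denote the optimal alignment score of $X$ and $Y$. Then there exist constants $c>0$ and $s>0$ such that, whenever $s(1,1)\geq s$, $$\mathrm{Var}(L_n)\geq c\, n \quad\text{for all } n\in\mathbb{N}.$$
   Context: An alignment of two strings $x=x_1\cdots x_n$, $y=y_1\cdots y_n$ is a pair of strictly increasing sequences $1\le \pi(1)<\cdots<\pi(k)\le n$ and $1\le\nu(1)<\cdots<\nu(k)\le n$ (for some $0\le k\le n$). Its score is $S_{(\pi,\nu)}=\sum_{i=1}^k s(x_{\pi(i)},y_{\nu(i)})$ (unaligned letters contribute nothing, since the gap penalty is $0$). The optimal alignment score is the maximum of $S_{(\pi,\nu)}$ over all alignments; an alignment attaining it is called optimal. *)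

theory Defs
  imports "HOL-Probability.Probability"
begin

text \<open>Letters are natural numbers 0 and 1; positions are 0-indexed.
  An alignment of two strings of length n is a pair of strictly increasing
  index lists of equal length k with entries below n.\<close>

definition alignments :: "nat \<Rightarrow> (nat list \<times> nat list) set" where
  "alignments n = {(ps, qs). length ps = length qs \<and> sorted_wrt (<) ps \<and> sorted_wrt (<) qs
                      \<and> set ps \<subseteq> {..<n} \<and> set qs \<subseteq> {..<n}}"

text \<open>Score of an alignment (gap penalty 0: unaligned letters contribute nothing).\<close>
definition align_score ::
  "(nat \<Rightarrow> nat \<Rightarrow> real) \<Rightarrow> nat list \<Rightarrow> nat list \<Rightarrow> nat list \<times> nat list \<Rightarrow> real" where
  "align_score s x y a = (\<Sum>(i, j) \<leftarrow> zip (fst a) (snd a). s (x ! i) (y ! j))"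

definition opt_score ::
  "(nat \<Rightarrow> nat \<Rightarrow> real) \<Rightarrow> nat \<Rightarrow> nat list \<Rightarrow> nat list \<Rightarrow> real" where
  "opt_score s n x y = Max (align_score s x y ` alignments n)"

definition binseqs :: "nat \<Rightarrow> nat list set" where
  "binseqs n = {xs. length xs = n \<and> set xs \<subseteq> {0, 1}}"

end

theory Submission
  imports Defs
begin

text \<open>Cut \<open>x\<close> into disjoint windows of length 4 and let \<open>W\<close> be the number of windows 1010 minus the
  number of windows 1100. Since \<open>W\<close> is centred with variance of order \<open>n\<close>, it suffices that its
  covariance with the score is at least linear in \<open>n\<close>. That covariance is the expected total change of
  the score when single windows 1100 are turned into 1010. Such an exchange costs at most one point,
  and if the window is aligned with a piece \<open>0\<^sup>i 1 0\<^sup>j 1 0\<^sup>l\<close> of \<open>y\<close>, its gain is at least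
  \<open>[j \<ge> 1] - [l \<ge> 2]\<close>, which has mean 1/4 for random \<open>y\<close>. If \<open>s(1,1) = t\<close> is large, an optimal alignment
  leaves only about \<open>n/t\<close> ones unaligned beyond the difference of the numbers of ones, so up to the
  cuts inside runs of zeros there are few candidates for the pieces of \<open>y\<close>. The union bound over
  them is an estimate of a partition function that penalises each unaligned one by the
  factor 1/4096; taking logarithms turns it into a bound on expectations.\<close>

section \<open>The alignment score as a recursion\<close>

text \<open>Every nonzero letter is treated as a 1, so the facts below hold for all lists of
  naturals; on binary words this is the scoring function with \<open>s 1 1 = t\<close>.\<close>

definition letter_score :: "real \<Rightarrow> nat \<Rightarrow> nat \<Rightarrow> real" where
  "letter_score t a b = (if a = 0 \<and> b = 0 then 1 else if a \<noteq> 0 \<and> b \<noteq> 0 then t else 0)"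

text \<open>Dynamic programming for a weighted longest common subsequence: either the two heads face
  each other (possibly for score 0), or one of them is skipped.\<close>

fun dp_score :: "real \<Rightarrow> nat list \<Rightarrow> nat list \<Rightarrow> real" where
  "dp_score t [] y = 0"
| "dp_score t (a # x) [] = 0"
| "dp_score t (a # x) (b # y) =
     max (letter_score t a b + dp_score t x y) (max (dp_score t (a # x) y) (dp_score t x (b # y)))"

lemma dp_score_Cons_cases:
  obtains "dp_score t (a # x) (b # y) = letter_score t a b + dp_score t x y"
  | "dp_score t (a # x) (b # y) = dp_score t (a # x) y"
  | "dp_score t (a # x) (b # y) = dp_score t x (b # y)"
  by (metis max_def dp_score.simps(3))

section \<open>Elementary properties of the score\<close>

definition ones :: "nat list \<Rightarrow> nat" where
  "ones x = length (filter (\<lambda>a. a \<noteq> 0) x)"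

definition zeros :: "nat list \<Rightarrow> nat" where
  "zeros x = length (filter (\<lambda>a. a = 0) x)"

lemma ones_simps [simp]:
  "ones [] = 0" "ones (a # x) = (if a = 0 then ones x else Suc (ones x))"
  "ones (x @ y) = ones x + ones y" "ones (replicate k 0) = 0"
  by (auto simp: ones_def)

lemma zeros_simps [simp]:
  "zeros [] = 0" "zeros (a # x) = (if a = 0 then Suc (zeros x) else zeros x)"
  "zeros (x @ y) = zeros x + zeros y" "zeros (replicate k 0) = k"
  by (auto simp: zeros_def)

lemma ones_le_length: "ones x \<le> length x" and zeros_le_length: "zeros x \<le> length x"
  by (auto simp: ones_def zeros_def)

lemma dp_score_Nil2 [simp]: "dp_score t x [] = 0"
  by (cases x) auto

lemma dp_score_Cons1: "dp_score t x y \<le> dp_score t (a # x) y" if "t \<ge> 0"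
proof (cases y)
  case Nil
  then show ?thesis by simp
next
  case (Cons b y')
  then show ?thesis by simp
qed

lemma dp_score_Cons2: "dp_score t x y \<le> dp_score t x (b # y)" if "t \<ge> 0"
  by (cases x) auto

lemma dp_score_append1: "t \<ge> 0 \<Longrightarrow> dp_score t x2 y \<le> dp_score t (x1 @ x2) y"
  by (induction x1) (auto intro: order_trans dp_score_Cons1)

lemma dp_score_append2: "t \<ge> 0 \<Longrightarrow> dp_score t x y2 \<le> dp_score t x (y1 @ y2)"
  by (induction y1) (auto intro: order_trans dp_score_Cons2)

lemma dp_score_nonneg: "t \<ge> 0 \<Longrightarrow> 0 \<le> dp_score t x y"
  using dp_score_append1[of t "[]" y x] by simp

text \<open>Alignments of the two pairs of pieces can be put side by side.\<close>

lemma dp_score_superadditive: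
  assumes "t \<ge> 0"
  shows "dp_score t x1 y1 + dp_score t x2 y2 \<le> dp_score t (x1 @ x2) (y1 @ y2)"
  using assms
proof (induction t x1 y1 rule: dp_score.induct)
  case (1 t y)
  then show ?case by (simp add: dp_score_append2)
next
  case (2 t a x)
  then show ?case using dp_score_append1[of t x2 y2 "a # x"] by simp
next
  case (3 t a x b y)
  then show ?case by (auto simp: max_def)
qed

text \<open>An optimal alignment does not cross, so \<open>y\<close> can be cut where the partners
  of \<open>x1\<close> end. The induction follows the optimal choice of the recursion and gives
  \<le>; superadditivity gives the converse.\<close>

lemma dp_score_split:
  assumes "t \<ge> 0"
  shows "\<exists>y1 y2. y = y1 @ y2 \<and> dp_score t (x1 @ x2) y = dp_score t x1 y1 + dp_score t x2 y2"
proof -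
  have "\<exists>y1 y2. y = y1 @ y2 \<and> dp_score t (x1 @ x2) y \<le> dp_score t x1 y1 + dp_score t x2 y2"
    using assms
  proof (induction t x1 y rule: dp_score.induct)
    case (1 t y)
    then show ?case by (intro exI[of _ "[]"] exI[of _ y]) simp
  next
    case (2 t a x)
    then show ?case by simp
  next
    case (3 t a x b y)
    consider "dp_score t ((a # x) @ x2) (b # y) = letter_score t a b + dp_score t (x @ x2) y"
      | "dp_score t ((a # x) @ x2) (b # y) = dp_score t ((a # x) @ x2) y"
      | "dp_score t ((a # x) @ x2) (b # y) = dp_score t (x @ x2) (b # y)"
      using dp_score_Cons_cases[of t a "x @ x2" b y] by auto
    then show ?case
    proof cases
      case 1
      from 3(1)[OF 3(4)] obtain u w where "y = u @ w"
        "dp_score t (x @ x2) y \<le> dp_score t x u + dp_score t x2 w" by blast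
      with 1 show ?thesis
        by (intro exI[of _ "b # u"] exI[of _ w]) auto
    next
      case 2
      from 3(2)[OF 3(4)] obtain u w where *: "y = u @ w"
        "dp_score t ((a # x) @ x2) y \<le> dp_score t (a # x) u + dp_score t x2 w" by blast
      have "b # y = (b # u) @ w" "dp_score t ((a # x) @ x2) (b # y) \<le> dp_score t (a # x) (b # u) + dp_score t x2 w"
        using * 2 dp_score_Cons2[OF 3(4), of "a # x" u b] by (simp, linarith)
      then show ?thesis by blast
    next
      case c: 3
      from 3(3)[OF 3(4)] obtain u w where *: "b # y = u @ w"
        "dp_score t (x @ x2) (b # y) \<le> dp_score t x u + dp_score t x2 w" by blast
      moreover have "dp_score t ((a # x) @ x2) (b # y) \<le> dp_score t (a # x) u + dp_score t x2 w"
        using * c dp_score_Cons1[OF 3(4), of x u a] by linarith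
      ultimately show ?thesis by blast
    qed
  qed
  then obtain y1 y2 where "y = y1 @ y2" "dp_score t (x1 @ x2) y \<le> dp_score t x1 y1 + dp_score t x2 y2"
    by blast
  with dp_score_superadditive[OF assms, of x1 y1 x2 y2] show ?thesis
    by (intro exI[of _ y1] exI[of _ y2]) auto
qed

text \<open>Each scoring pair uses up one 1 of both words or one 0 of both words.\<close>

lemma dp_score_le:
  assumes "t \<ge> 0"
  shows "dp_score t x y \<le> t * real (min (ones x) (ones y)) + real (min (zeros x) (zeros y))"
  using assms
proof (induction t x y rule: dp_score.induct)
  case (3 t a x b y)
  have mono: "t * real k + real l \<le> t * real k' + real l'" if "k \<le> k'" "l \<le> l'" for k k' l l'
    using that 3(4) by (intro add_mono mult_left_mono) auto
  have "letter_score t a b + dp_score t x y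
      \<le> t * real (min (ones (a # x)) (ones (b # y))) + real (min (zeros (a # x)) (zeros (b # y)))"
  proof (cases "(a = 0) = (b = 0)")
    case True
    then show ?thesis using 3(1)[OF 3(4)]
      by (auto simp: letter_score_def min_Suc_Suc algebra_simps)
  next
    case False
    then have "letter_score t a b = 0" by (auto simp: letter_score_def)
    moreover have "t * real (min (ones x) (ones y)) + real (min (zeros x) (zeros y))
      \<le> t * real (min (ones (a # x)) (ones (b # y))) + real (min (zeros (a # x)) (zeros (b # y)))"
      by (rule mono) auto
    ultimately show ?thesis using 3(1)[OF 3(4)] by linarith
  qed
  moreover have "dp_score t (a # x) y
      \<le> t * real (min (ones (a # x)) (ones (b # y))) + real (min (zeros (a # x)) (zeros (b # y)))"
    by (rule order_trans[OF 3(2)[OF 3(4)] mono]) auto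
  moreover have "dp_score t x (b # y)
      \<le> t * real (min (ones (a # x)) (ones (b # y))) + real (min (zeros (a # x)) (zeros (b # y)))"
    by (rule order_trans[OF 3(3)[OF 3(4)] mono]) auto
  ultimately show ?case by simp
qed auto

text \<open>Align the ones in order and leave all zeros unaligned.\<close>

lemma dp_score_ge: "t \<ge> 0 \<Longrightarrow> t * real (min (ones x) (ones y)) \<le> dp_score t x y"
proof (induction t x y rule: dp_score.induct)
  case (3 t a x b y)
  consider "a \<noteq> 0" "b \<noteq> 0" | "a = 0" | "a \<noteq> 0" "b = 0" by blast
  then show ?case
  proof cases
    case 1
    then show ?thesis using 3(1)[OF 3(4)]
      by (auto simp: letter_score_def min_Suc_Suc algebra_simps le_max_iff_disj)
  next
    case 2
    then show ?thesis using 3(3)[OF 3(4)] by (auto simp: le_max_iff_disj)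
  next
    case c: 3
    then show ?thesis using 3(2)[OF 3(4)] by (auto simp: le_max_iff_disj)
  qed
qed auto

text \<open>If both index lists start with 0, the heads are aligned with each other. Otherwise one
  list starts with a positive index, so that head is unaligned and can be removed.\<close>

lemma align_score_le_dp_score:
  assumes "t \<ge> 0" "length ps = length qs" "sorted_wrt (<) ps" "sorted_wrt (<) qs"
    "set ps \<subseteq> {..<length x}" "set qs \<subseteq> {..<length y}"
  shows "(\<Sum>(i, j) \<leftarrow> zip ps qs. letter_score t (x ! i) (y ! j)) \<le> dp_score t x y"
  using assms
proof (induction t x y arbitrary: ps qs rule: dp_score.induct)
  case (3 t a x b y)
  \<comment> \<open>Removal of a head shifts indices down by one. The truncation of
    \<open>0 - 1\<close> is harmless, since \<open>pd\<close> is applied only to lists without 0,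
    where it inverts \<open>map Suc\<close>.\<close>
  define pd where "pd = map (\<lambda>i::nat. i - 1)"
  have pd: "sorted_wrt (<) (pd ps)" "set (pd ps) \<subseteq> {..<l}" "map Suc (pd ps) = ps"
    if "sorted_wrt (<) ps" "set ps \<subseteq> {..<Suc l}" "0 \<notin> set ps" for ps l
  proof -
    have pos: "\<forall>i\<in>set ps. 0 < i" using that(3) by (metis gr0I)
    show "sorted_wrt (<) (pd ps)" unfolding pd_def sorted_wrt_map
      using that(1) by (rule sorted_wrt_mono_rel[rotated]) (use pos in fastforce)
    show "set (pd ps) \<subseteq> {..<l}" using that(2) pos by (force simp: pd_def)
    show "map Suc (pd ps) = ps" using pos by (simp add: pd_def map_idI)
  qed
  have nonneg: "0 \<le> dp_score t (a # x) (b # y)" using 3 dp_score_nonneg by blast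
  show ?case
  proof (cases ps)
    case Nil
    then show ?thesis using nonneg by simp
  next
    case (Cons p ps')
    then obtain q qs' where qs: "qs = q # qs'" using 3(5) by (cases qs) auto
    consider "p = 0" "q = 0" | "p > 0" | "q > 0" by auto
    then show ?thesis
    proof cases
      case 1
      have ps': "0 \<notin> set ps'" "sorted_wrt (<) ps'" "set ps' \<subseteq> {..<Suc (length x)}"
        using 3 Cons 1 by auto
      have qs': "0 \<notin> set qs'" "sorted_wrt (<) qs'" "set qs' \<subseteq> {..<Suc (length y)}"
        using 3 qs 1 by auto
      have "(\<Sum>(i, j) \<leftarrow> zip ps' qs'. letter_score t ((a # x) ! i) ((b # y) ! j))
          = (\<Sum>(i, j) \<leftarrow> zip (map Suc (pd ps')) (map Suc (pd qs')). letter_score t ((a # x) ! i) ((b # y) ! j))"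
        using ps' qs' by (simp add: pd(3))
      also have "\<dots> = (\<Sum>(i, j) \<leftarrow> zip (pd ps') (pd qs'). letter_score t (x ! i) (y ! j))"
        unfolding zip_map_map map_map by (simp add: o_def split_def)
      also have "\<dots> \<le> dp_score t x y"
        using 3 Cons qs pd[OF ps'(2,3,1)] pd[OF qs'(2,3,1)]
        by (intro 3(1)) (auto simp: pd_def)
      finally show ?thesis using 1 Cons qs by simp
    next
      case 2
      have ps': "0 \<notin> set ps" "sorted_wrt (<) ps" "set ps \<subseteq> {..<Suc (length x)}"
        using 3 Cons 2 by auto
      have "(\<Sum>(i, j) \<leftarrow> zip ps qs. letter_score t ((a # x) ! i) ((b # y) ! j))
          = (\<Sum>(i, j) \<leftarrow> zip (map Suc (pd ps)) qs. letter_score t ((a # x) ! i) ((b # y) ! j))"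
        using ps' by (simp add: pd(3))
      also have "\<dots> = (\<Sum>(i, j) \<leftarrow> zip (pd ps) qs. letter_score t (x ! i) ((b # y) ! j))"
        unfolding zip_map1 map_map by (simp add: o_def split_def)
      also have "\<dots> \<le> dp_score t x (b # y)"
        using 3 pd[OF ps'(2,3,1)] by (intro 3(3)) (auto simp: pd_def)
      finally show ?thesis by simp
    next
      case c: 3
      have qs': "0 \<notin> set qs" "sorted_wrt (<) qs" "set qs \<subseteq> {..<Suc (length y)}"
        using 3 qs c by auto
      have "(\<Sum>(i, j) \<leftarrow> zip ps qs. letter_score t ((a # x) ! i) ((b # y) ! j))
          = (\<Sum>(i, j) \<leftarrow> zip ps (map Suc (pd qs)). letter_score t ((a # x) ! i) ((b # y) ! j))"
        using qs' by (simp add: pd(3))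
      also have "\<dots> = (\<Sum>(i, j) \<leftarrow> zip ps (pd qs). letter_score t ((a # x) ! i) (y ! j))"
        unfolding zip_map2 map_map by (simp add: o_def split_def)
      also have "\<dots> \<le> dp_score t (a # x) y"
        using 3 pd[OF qs'(2,3,1)] by (intro 3(2)) (auto simp: pd_def)
      finally show ?thesis by simp
    qed
  qed
qed auto

lemma align_score_attains_dp_score:
  "\<exists>ps qs. length ps = length qs \<and> sorted_wrt (<) ps \<and> sorted_wrt (<) qs
     \<and> set ps \<subseteq> {..<length x} \<and> set qs \<subseteq> {..<length y}
     \<and> (\<Sum>(i, j) \<leftarrow> zip ps qs. letter_score t (x ! i) (y ! j)) = dp_score t x y"
proof (induction t x y rule: dp_score.induct)
  case (3 t a x b y)
  have S: "sorted_wrt (<) (map Suc l)" if "sorted_wrt (<) l" for l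
    using that by (simp add: sorted_wrt_map)
  consider "dp_score t (a # x) (b # y) = letter_score t a b + dp_score t x y"
    | "dp_score t (a # x) (b # y) = dp_score t (a # x) y"
    | "dp_score t (a # x) (b # y) = dp_score t x (b # y)"
    using dp_score_Cons_cases by blast
  then show ?case
  proof cases
    case 1
    from 3(1) obtain ps qs where *: "length ps = length qs" "sorted_wrt (<) ps" "sorted_wrt (<) qs"
      "set ps \<subseteq> {..<length x}" "set qs \<subseteq> {..<length y}"
      "(\<Sum>(i, j) \<leftarrow> zip ps qs. letter_score t (x ! i) (y ! j)) = dp_score t x y" by blast
    then show ?thesis
      unfolding 1
      by (intro exI[of _ "0 # map Suc ps"] exI[of _ "0 # map Suc qs"])
         (auto simp: S zip_map_map o_def split_def)
  next
    case 2
    from 3(2) obtain ps qs where *: "length ps = length qs" "sorted_wrt (<) ps" "sorted_wrt (<) qs"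
      "set ps \<subseteq> {..<length (a # x)}" "set qs \<subseteq> {..<length y}"
      "(\<Sum>(i, j) \<leftarrow> zip ps qs. letter_score t ((a # x) ! i) (y ! j)) = dp_score t (a # x) y" by blast
    then show ?thesis
      unfolding 2
      by (intro exI[of _ ps] exI[of _ "map Suc qs"])
         (auto simp: S zip_map2 o_def split_def)
  next
    case c: 3
    from 3(3) obtain ps qs where *: "length ps = length qs" "sorted_wrt (<) ps" "sorted_wrt (<) qs"
      "set ps \<subseteq> {..<length x}" "set qs \<subseteq> {..<length (b # y)}"
      "(\<Sum>(i, j) \<leftarrow> zip ps qs. letter_score t (x ! i) ((b # y) ! j)) = dp_score t x (b # y)" by blast
    then show ?thesis
      unfolding c
      by (intro exI[of _ "map Suc ps"] exI[of _ qs])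
         (auto simp: S zip_map1 o_def split_def)
  qed
qed (auto intro!: exI[of _ "[]"])

lemma finite_alignments: "finite (alignments n)"
proof -
  have len: "length ps \<le> n" if "sorted_wrt (<) ps" "set ps \<subseteq> {..<n}" for ps
  proof -
    have "distinct ps" using that(1) by (simp add: strict_sorted_iff)
    then have "length ps = card (set ps)" by (simp add: distinct_card)
    also have "\<dots> \<le> n" using card_mono[OF _ that(2)] by simp
    finally show ?thesis .
  qed
  have "alignments n \<subseteq> {ps. set ps \<subseteq> {..<n} \<and> length ps \<le> n} \<times> {ps. set ps \<subseteq> {..<n} \<and> length ps \<le> n}"
    using len by (auto simp: alignments_def)
  then show ?thesis by (rule finite_subset) (simp add: finite_lists_length_le)
qed

lemma opt_score_eq_dp_score:
  assumes s: "s 1 0 = 0" "s 0 1 = 0" "s 0 0 = 1" "s 1 1 \<ge> 0"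
    and x: "x \<in> binseqs n" and y: "y \<in> binseqs n"
  shows "opt_score s n x y = dp_score (s 1 1) x y"
proof -
  have len: "length x = n" "length y = n" using x y by (auto simp: binseqs_def)
  have eq: "align_score s x y (ps, qs) = (\<Sum>(i, j) \<leftarrow> zip ps qs. letter_score (s 1 1) (x ! i) (y ! j))"
    if "(ps, qs) \<in> alignments n" for ps qs
  proof -
    have "s (x ! i) (y ! j) = letter_score (s 1 1) (x ! i) (y ! j)" if "(i, j) \<in> set (zip ps qs)" for i j
    proof -
      have "i < n" "j < n" using \<open>(ps, qs) \<in> alignments n\<close> set_zip_leftD[OF that] set_zip_rightD[OF that]
        by (auto simp: alignments_def)
      then have "x ! i \<in> set x" "y ! j \<in> set y" using len by auto
      then have "x ! i \<in> {0, 1}" "y ! j \<in> {0, 1}"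
        using x y unfolding binseqs_def by blast+
      then show ?thesis using s by (auto simp: letter_score_def)
    qed
    then show ?thesis unfolding align_score_def fst_conv snd_conv
      by (intro arg_cong[of _ _ sum_list] map_cong) auto
  qed
  show ?thesis unfolding opt_score_def
  proof (rule Max_eqI)
    show "finite (align_score s x y ` alignments n)" by (simp add: finite_alignments)
    show "b \<le> dp_score (s 1 1) x y" if "b \<in> align_score s x y ` alignments n" for b
    proof -
      from that obtain ps qs where a: "(ps, qs) \<in> alignments n" "b = align_score s x y (ps, qs)" by auto
      show ?thesis unfolding a(2) eq[OF a(1)]
        using a(1) s(4) len by (intro align_score_le_dp_score) (auto simp: alignments_def)
    qed
    obtain ps qs where "length ps = length qs" "sorted_wrt (<) ps" "sorted_wrt (<) qs"
      "set ps \<subseteq> {..<length x}" "set qs \<subseteq> {..<length y}"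
      "(\<Sum>(i, j) \<leftarrow> zip ps qs. letter_score (s 1 1) (x ! i) (y ! j)) = dp_score (s 1 1) x y"
      using align_score_attains_dp_score by blast
    then have "(ps, qs) \<in> alignments n" "align_score s x y (ps, qs) = dp_score (s 1 1) x y"
      using len eq by (auto simp: alignments_def)
    then show "dp_score (s 1 1) x y \<in> align_score s x y ` alignments n" by (metis imageI)
  qed
qed

section \<open>Exchanging one window\<close>

definition winA :: "nat list" where "winA = [1, 1, 0, 0]"
definition winB :: "nat list" where "winB = [1, 0, 1, 0]"

lemma ones_winA [simp]: "ones winA = 2" by (simp add: winA_def)

text \<open>Keep the partners of both ones and of the last zero of \<open>winA\<close>. Only the
  first zero is given up, and it earns at most 1.\<close>

lemma window_exchange_ge:
  assumes "t \<ge> 0"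
  shows "dp_score t winA v - 1 \<le> dp_score t winB v"
proof -
  obtain v1 v2 where v: "v = v1 @ v2" "dp_score t winA v = dp_score t [1, 1] v1 + dp_score t [0, 0] v2"
    using dp_score_split[OF assms, of v "[1, 1]" "[0, 0]"] by (auto simp: winA_def)
  obtain u1 u2 where u: "v1 = u1 @ u2" "dp_score t [1, 1] v1 = dp_score t [1] u1 + dp_score t [1] u2"
    using dp_score_split[OF assms, of v1 "[1]" "[1]"] by auto
  obtain w1 w2 where w: "v2 = w1 @ w2" "dp_score t [0, 0] v2 = dp_score t [0] w1 + dp_score t [0] w2"
    using dp_score_split[OF assms, of v2 "[0]" "[0]"] by auto
  have "dp_score t [1] u2 \<le> dp_score t [0, 1] u2" by (rule dp_score_Cons1[OF assms])
  moreover have "dp_score t [1] u1 + dp_score t [0, 1] u2 \<le> dp_score t [1, 0, 1] v1"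
    using dp_score_superadditive[OF assms, of "[1]" u1 "[0, 1]" u2] u by simp
  moreover have "dp_score t [1, 0, 1] v1 + dp_score t [0] v2 \<le> dp_score t winB v"
    using dp_score_superadditive[OF assms, of "[1, 0, 1]" v1 "[0]" v2] v by (simp add: winB_def)
  moreover have "dp_score t [0] w1 \<le> 1"
    using dp_score_le[OF assms, of "[0]" w1] by simp
  moreover have "dp_score t [0] w2 \<le> dp_score t [0] v2" unfolding w(1) by (rule dp_score_append2[OF assms])
  ultimately show ?thesis using u v w by linarith
qed

text \<open>For large \<open>t\<close> both ones of 1100 must be aligned, so its zeros can only use
  the last run: score at most \<open>2 * t + min 2 l\<close>. The word 1010 can be aligned block by
  block and earns a point for each of the inner and the last run that is nonempty.\<close>

lemma window_exchange_two_ones: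
  assumes t: "t \<ge> 2" and ab: "a \<noteq> 0" "b \<noteq> 0"
    and v: "v = replicate i 0 @ a # replicate j 0 @ b # replicate l 0"
  shows "dp_score t winA v + of_bool (j \<ge> 1) - of_bool (l \<ge> 2) \<le> dp_score t winB v"
proof -
  have t0: "t \<ge> 0" using t by simp
  have upper: "dp_score t winA v \<le> 2 * t + real (min 2 l)"
  proof -
    obtain v1 v2 where v12: "v = v1 @ v2" "dp_score t winA v = dp_score t [1, 1] v1 + dp_score t [0, 0] v2"
      using dp_score_split[OF t0, of v "[1, 1]" "[0, 0]"] by (auto simp: winA_def)
    have 1: "dp_score t [1, 1] v1 \<le> t * real (min 2 (ones v1))"
      using dp_score_le[OF t0, of "[1, 1]" v1] by simp
    have 2: "dp_score t [0, 0] v2 \<le> real (min 2 (zeros v2))"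
      using dp_score_le[OF t0, of "[0, 0]" v2] by simp
    have o: "ones v1 + ones v2 = 2"
      using arg_cong[OF v12(1), of ones] v ab by simp
    show ?thesis
    proof (cases "ones v1 = 2")
      case True
      then have "ones v2 = 0" using o by simp
      then have z2: "\<forall>c\<in>set v2. c = 0" by (auto simp: ones_def filter_empty_conv)
      have "length v2 \<le> l"
      proof (rule ccontr)
        assume "\<not> length v2 \<le> l"
        moreover have "length v1 + length v2 = i + j + l + 2"
          using arg_cong[OF v12(1), of length] v by simp
        ultimately have "length v1 \<le> i + j + 1" by simp
        moreover have "v2 = drop (length v1) v" by (simp add: v12(1))
        moreover have "drop (i + j + 1) v = b # replicate l 0" using v by simp
        ultimately have "b \<in> set v2"
          by (metis set_drop_subset_set_drop list.set_intros(1) subsetD)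
        then show False using z2 ab by auto
      qed
      then have "zeros v2 \<le> l" using zeros_le_length[of v2] by simp
      then have "real (min 2 (zeros v2)) \<le> real (min 2 l)" by auto
      then show ?thesis using 1 2 v12 True by simp
    next
      case False
      \<comment> \<open>Here a one is lost, which costs \<open>t\<close>; the two zeros earn at most
        2, and \<open>t \<ge> 2\<close>.\<close>
      then have "ones v1 \<le> 1" using o by simp
      then have "t * real (min 2 (ones v1)) \<le> t * 1" using t0 by (intro mult_left_mono) auto
      moreover have "real (min 2 (zeros v2)) \<le> 2" by simp
      ultimately show ?thesis using 1 2 v12(2) t by linarith
    qed
  qed
  have zero_block: "of_bool (k \<ge> 1) \<le> dp_score t [0] (replicate k 0)" for k
    using dp_score_nonneg[OF t0] by (cases k) (auto simp: letter_score_def le_max_iff_disj)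
  have one_block: "t \<le> dp_score t [1] (replicate k 0 @ [c])" if "c \<noteq> 0" for k c
    using dp_score_ge[OF t0, of "[1]" "replicate k 0 @ [c]"] that by simp
  have "t + of_bool (j \<ge> 1) + t + of_bool (l \<ge> 1)
     \<le> dp_score t [1] (replicate i 0 @ [a]) + dp_score t [0] (replicate j 0) + dp_score t [1] [b] + dp_score t [0] (replicate l 0)"
    using one_block[OF ab(1), of i] one_block[OF ab(2), of 0] zero_block[of j] zero_block[of l] by simp
  also have "\<dots> \<le> dp_score t ([1] @ [0] @ [1] @ [0]) ((replicate i 0 @ [a]) @ replicate j 0 @ [b] @ replicate l 0)"
    using dp_score_superadditive[OF t0, of "[1]" "[b]" "[0]" "replicate l 0"]
      dp_score_superadditive[OF t0, of "[0]" "replicate j 0" "[1] @ [0]" "[b] @ replicate l 0"]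
      dp_score_superadditive[OF t0, of "[1]" "replicate i 0 @ [a]" "[0] @ [1] @ [0]" "replicate j 0 @ [b] @ replicate l 0"]
    by linarith
  also have "\<dots> = dp_score t winB v" using v by (simp add: winB_def)
  finally have "2 * t + of_bool (j \<ge> 1) + of_bool (l \<ge> 1) \<le> dp_score t winB v" by simp
  moreover have "real (min 2 l) = of_bool (l \<ge> 1) + of_bool (l \<ge> 2)" by auto
  ultimately show ?thesis using upper by linarith
qed

section \<open>The partition function\<close>

text \<open>A canonical cut: the shortest prefix with \<open>k\<close> ones is dropped. Any other
  cut behind exactly \<open>k\<close> ones differs only by leading zeros of the remainder. The
  default is \<open>[]\<close> if the ones run out.\<close>

fun after_ones :: "nat \<Rightarrow> nat list \<Rightarrow> nat list" where
  "after_ones 0 y = y"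
| "after_ones (Suc k) [] = []"
| "after_ones (Suc k) (a # y) = (if a = 0 then after_ones (Suc k) y else after_ones k y)"

text \<open>For \<open>f\<close> insensitive to leading zeros, \<open>two_weight f (0\<^sup>i 1 0\<^sup>j 1 0\<^sup>l @ y)\<close> equals \<open>2\<^sup>-\<^sup>g * f y\<close> with
  \<open>g = [j \<ge> 1] - [l \<ge> 2]\<close>, if \<open>0\<^sup>l\<close> is a maximal run.\<close>

definition run_weight :: "(nat list \<Rightarrow> real) \<Rightarrow> nat list \<Rightarrow> real" where
  "run_weight f y = (if take 2 y = [0, 0] then 2 else 1) * f y"

fun gap_weight :: "(nat list \<Rightarrow> real) \<Rightarrow> nat list \<Rightarrow> real" where
  "gap_weight f [] = 0"
| "gap_weight f (a # y) = (if a = 0 then run_weight f (after_ones 1 y) / 2 else run_weight f y)"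

fun two_weight :: "(nat list \<Rightarrow> real) \<Rightarrow> nat list \<Rightarrow> real" where
  "two_weight f [] = 0"
| "two_weight f (a # y) = (if a = 0 then two_weight f y else gap_weight f y)"

definition nat_dist :: "nat \<Rightarrow> nat \<Rightarrow> nat" where
  "nat_dist k m = (k - m) + (m - k)"

text \<open>One factor of the partition function: \<open>k\<close> is the number of ones in the piece of \<open>y\<close>
  opposite the window \<open>X\<close>. Up to zeros at the cuts, the pieces are determined by these numbers.\<close>

definition window_sum :: "nat \<Rightarrow> nat list \<Rightarrow> (nat list \<Rightarrow> real) \<Rightarrow> nat list \<Rightarrow> real" where
  "window_sum n X f y = (\<Sum>k\<le>n. (1/4096) ^ nat_dist k (ones X) *
     (if X = winA then if k = 2 then two_weight f y else 2 * f (after_ones k y)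
      else f (after_ones k y)))"

text \<open>A transfer operator over the windows of \<open>x\<close>, acting on functions of the
  part of \<open>y\<close> still to be aligned. A remainder of fewer than four letters has weight 1,
  and \<open>n\<close> is to be a bound on the length of \<open>y\<close>, hence on the ones of each
  piece.\<close>

fun partition_fun :: "nat \<Rightarrow> nat list \<Rightarrow> nat list \<Rightarrow> real" where
  "partition_fun n (a # b # c # d # x) = window_sum n [a, b, c, d] (partition_fun n x)"
| "partition_fun n x = (\<lambda>y. 1)"

text \<open>The windows are exchanged one at a time, each in the original word; the letters already
  passed are stored inside \<open>f\<close>.\<close>

fun exchange_gain :: "(nat list \<Rightarrow> real) \<Rightarrow> nat list \<Rightarrow> real" where
  "exchange_gain f (a # b # c # d # x) =
     (if [a, b, c, d] = winA then f (winB @ x) - f (winA @ x) else 0)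
     + exchange_gain (\<lambda>z. f ([a, b, c, d] @ z)) x"
| "exchange_gain f x = 0"

text \<open>This makes the exact position of a cut inside a run of zeros irrelevant, so that only
  the numbers of ones need to be summed over.\<close>

definition zero_insensitive :: "(nat list \<Rightarrow> real) \<Rightarrow> bool" where
  "zero_insensitive f \<longleftrightarrow> (\<forall>y. 0 \<le> f y \<and> f (0 # y) = f y)"

section \<open>Invariance under leading zeros\<close>

lemma zero_insensitiveD:
  assumes "zero_insensitive f"
  shows "0 \<le> f y" "f (0 # y) = f y" "f (replicate k 0 @ y) = f y"
  using assms by (auto simp: zero_insensitive_def, induction k) auto

lemma run_weight_nonneg: "zero_insensitive f \<Longrightarrow> 0 \<le> run_weight f y"
  by (simp add: run_weight_def zero_insensitiveD)

lemma gap_weight_nonneg: "zero_insensitive f \<Longrightarrow> 0 \<le> gap_weight f y"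
  by (cases y) (auto simp: run_weight_nonneg)

lemma two_weight_nonneg: "zero_insensitive f \<Longrightarrow> 0 \<le> two_weight f y"
  by (induction y) (auto simp: gap_weight_nonneg)

lemma after_ones_zero:
  "zero_insensitive f \<Longrightarrow> f (after_ones k (0 # y)) = f (after_ones k y)"
  by (cases k) (auto simp: zero_insensitiveD)

lemma after_ones_append:
  assumes "zero_insensitive f"
  shows "f (after_ones (ones v) (v @ y)) = f y"
proof (induction v)
  case (Cons a v)
  then show ?case using after_ones_zero[OF assms, of "ones v" "v @ y"] by (cases "a = 0") auto
qed simp

lemma zero_insensitive_window_sum:
  assumes "zero_insensitive f"
  shows "zero_insensitive (window_sum n X f)"
  unfolding zero_insensitive_def
proof (intro allI conjI)
  fix y
  show "0 \<le> window_sum n X f y" unfolding window_sum_def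
    by (intro sum_nonneg) (auto simp: zero_insensitiveD[OF assms] two_weight_nonneg[OF assms])
  show "window_sum n X f (0 # y) = window_sum n X f y"
    unfolding window_sum_def by (intro sum.cong) (auto simp: after_ones_zero[OF assms])
qed

lemma zero_insensitive_partition_fun: "zero_insensitive (partition_fun n x)"
  by (induction n x rule: partition_fun.induct)
     (simp_all add: zero_insensitive_window_sum, simp_all add: zero_insensitive_def)

section \<open>Pointwise lower bound for the partition function\<close>

lemma ones_eq_SucE:
  assumes "ones v = Suc k"
  obtains i a w where "v = replicate i 0 @ a # w" "a \<noteq> 0" "ones w = k"
  using assms
proof (induction v arbitrary: thesis)
  case (Cons c v)
  show ?case
  proof (cases "c = 0")
    case True
    then have "ones v = Suc k" using Cons by simp
    then obtain i a w where "v = replicate i 0 @ a # w" "a \<noteq> 0" "ones w = k"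
      using Cons.IH by blast
    then show thesis using Cons.prems(1)[of "Suc i" a w] True by simp
  next
    case False
    then show thesis using Cons.prems(1)[of 0 c v] Cons.prems(2) by simp
  qed
qed simp

lemma ones_eq_0: "ones w = 0 \<Longrightarrow> w = replicate (length w) 0"
  by (induction w) (auto split: if_splits)

lemma after_ones_replicate:
  "b \<noteq> 0 \<Longrightarrow> after_ones 1 (replicate j 0 @ b # z) = z"
  by (induction j) auto

lemma two_weight_replicate: "two_weight f (replicate i 0 @ z) = two_weight f z"
  by (induction i) auto

text \<open>Write \<open>v\<close> as \<open>0\<^sup>i 1 0\<^sup>j 1 0\<^sup>l\<close> and apply the
  gain of the exchange. The last run of zeros may continue into \<open>y\<close>; this can only
  increase the weight.\<close>

lemma two_weight_ge:
  assumes f: "zero_insensitive f" and t: "t \<ge> 2" and v: "ones v = 2"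
  shows "2 powr - (dp_score t winB v - dp_score t winA v) * f y \<le> two_weight f (v @ y)"
proof -
  obtain i a w where 1: "v = replicate i 0 @ a # w" "a \<noteq> 0" "ones w = 1"
    using ones_eq_SucE[of v 1] v by auto
  obtain j b u where 2: "w = replicate j 0 @ b # u" "b \<noteq> 0" "ones u = 0"
    using ones_eq_SucE[of w 0] 1(3) by auto
  define l where "l = length u"
  have u: "u = replicate l 0" unfolding l_def by (rule ones_eq_0[OF 2(3)])
  have veq: "v = replicate i 0 @ a # replicate j 0 @ b # replicate l 0"
    using 1 2 u by simp
  have "2 powr - (dp_score t winB v - dp_score t winA v) \<le> 2 powr - (of_bool (j \<ge> 1) - of_bool (l \<ge> 2))"
    using window_exchange_two_ones[OF t 1(2) 2(2) veq] by simp
  also have "\<dots> = (if j \<ge> 1 then 1/2 else 1) * (if l \<ge> 2 then 2 else (1::real))"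
    by (auto simp: powr_minus)
  finally have "2 powr - (dp_score t winB v - dp_score t winA v) * f y
      \<le> (if j \<ge> 1 then 1/2 else 1) * ((if l \<ge> 2 then 2 else 1) * f y)"
    using zero_insensitiveD(1)[OF f] by (metis mult.assoc mult_right_mono)
  also have "(if l \<ge> 2 then 2 else 1) * f y \<le> run_weight f (replicate l 0 @ y)"
  proof (cases "l \<ge> 2")
    case True
    then have "replicate l (0::nat) = [0, 0] @ replicate (l - 2) 0"
      by (metis Suc_1 le_add_diff_inverse replicate_0 replicate_Suc replicate_add One_nat_def)
    then have "take 2 (replicate l (0::nat) @ y) = [0, 0]" by simp
    then show ?thesis using True by (simp add: run_weight_def zero_insensitiveD[OF f])
  next
    case False
    then show ?thesis using zero_insensitiveD(1)[OF f, of y] by (simp add: run_weight_def zero_insensitiveD(3)[OF f])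
  qed
  also have "(if j \<ge> 1 then 1/2 else 1) * run_weight f (replicate l 0 @ y)
      = gap_weight f (replicate j 0 @ b # replicate l 0 @ y)"
    using 2(2) after_ones_replicate[OF 2(2)] by (cases j) auto
  also have "\<dots> = two_weight f (v @ y)"
    unfolding veq using 1(2) by (simp add: two_weight_replicate)
  finally show ?thesis by (simp split: if_splits)
qed

lemma nat_dist_min: "real (min k m) = (real k + real m - real (nat_dist k m)) / 2"
  by (auto simp: nat_dist_def min_def)

lemma dp_score_le_nat_dist:
  assumes "t \<ge> 0"
  shows "dp_score t x y \<le> t * (real (ones x) + real (ones y) - real (nat_dist (ones x) (ones y))) / 2 + real (length x)"
proof -
  have "real (min (zeros x) (zeros y)) \<le> real (length x)" using zeros_le_length[of x] by simp
  then show ?thesis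
    using dp_score_le[OF assms, of x y] nat_dist_min[of "ones x" "ones y"] by simp
qed

lemma short_dp_score_le:
  assumes "t \<ge> 2"
  shows "\<exists>e. (1/4096::real) ^ e \<le> 1
     \<and> dp_score t x y \<le> t * (real (ones x) + real (ones y) - real e) / 2 + real (length x)"
  using assms dp_score_le_nat_dist[of t x y] by (intro exI[of _ "nat_dist (ones x) (ones y)"]) (simp add: power_le_one)

text \<open>Cut an optimal alignment along the windows of \<open>x\<close>; the term of the
  partition function for these cuts already dominates the left side. The exponent \<open>e\<close>
  adds up the differences of the numbers of ones, and the second conjunct shows that a large
  \<open>e\<close> is paid for by the score. The hypotheses on \<open>f\<close> describe the score
  when the windows already passed are frozen against their pieces with total score \<open>c\<close>:
  a lower bound in general, exact at \<open>x\<close>.\<close>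

lemma partition_fun_ge:
  assumes "t \<ge> 2" and "\<And>z. c + dp_score t z y \<le> f z" and "f x = c + dp_score t x y" and "length y \<le> n"
  shows "\<exists>e. 2 powr - exchange_gain f x * (1/4096) ^ e \<le> partition_fun n x y
     \<and> dp_score t x y \<le> t * (real (ones x) + real (ones y) - real e) / 2 + real (length x)"
  using assms
proof (induction f x arbitrary: c y rule: exchange_gain.induct)
  case (1 f a1 a2 a3 a4 x)
  define X where "X = [a1, a2, a3, a4]"
  have X: "a1 # a2 # a3 # a4 # x = X @ x" by (simp add: X_def)
  have t0: "t \<ge> 0" using 1 by simp
  obtain v w where y: "y = v @ w" and split: "dp_score t (X @ x) y = dp_score t X v + dp_score t x w"
    using dp_score_split[OF t0] by blast
  \<comment> \<open>Freeze the first window against \<open>v\<close>: its score joins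
    \<open>c\<close>, and both hypotheses on \<open>f\<close> persist for the remaining
    word.\<close>
  have "\<exists>e. 2 powr - exchange_gain (\<lambda>z. f ([a1, a2, a3, a4] @ z)) x * (1/4096) ^ e \<le> partition_fun n x w
     \<and> dp_score t x w \<le> t * (real (ones x) + real (ones w) - real e) / 2 + real (length x)"
  proof (rule "1.IH")
    show "c + dp_score t X v + dp_score t z w \<le> f ([a1, a2, a3, a4] @ z)" for z
      using 1(3)[of "X @ z"] dp_score_superadditive[OF t0, of X v z w] y by (simp add: X_def)
    show "f ([a1, a2, a3, a4] @ x) = c + dp_score t X v + dp_score t x w"
      using 1(4) split X_def by simp
  qed (use 1 y in auto)
  then obtain e where e: "2 powr - exchange_gain (\<lambda>z. f (X @ z)) x * (1/4096) ^ e \<le> partition_fun n x w"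
     "dp_score t x w \<le> t * (real (ones x) + real (ones w) - real e) / 2 + real (length x)"
    unfolding X_def by blast
  define g where "g = partition_fun n x"
  have g: "zero_insensitive g" unfolding g_def by (rule zero_insensitive_partition_fun)
  define k where "k = ones v"
  define d where "d = nat_dist k (ones X)"
  define r where "r = (if X = winA then f (winB @ x) - f (winA @ x) else 0)"
  have after: "g (after_ones k y) = g w" unfolding k_def y by (rule after_ones_append[OF g])
  \<comment> \<open>The old cut of \<open>y\<close> is still available after the exchange, so the
    true gain is at least the gain against \<open>v\<close>.\<close>
  have r: "dp_score t winB v - dp_score t winA v \<le> r" if "X = winA"
  proof -
    have "c + (dp_score t winB v + dp_score t x w) \<le> f (winB @ x)"
      using 1(3)[of "winB @ x"] dp_score_superadditive[OF t0, of winB v x w] y by simp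
    moreover have "f (winA @ x) = c + (dp_score t winA v + dp_score t x w)"
      using 1(4) split that unfolding X by simp
    ultimately show ?thesis using that by (simp add: r_def)
  qed
  \<comment> \<open>With two ones in \<open>v\<close> the gain is encoded in
    \<open>two_weight\<close>; otherwise a loss of at most one point is covered by the factor
    2.\<close>
  have key: "2 powr - r * g w \<le> (if X = winA then if k = 2 then two_weight g y else 2 * g (after_ones k y)
      else g (after_ones k y))"
  proof (cases "X = winA")
    case False
    then show ?thesis by (simp add: r_def after)
  next
    case True
    have gw: "0 \<le> g w" by (rule zero_insensitiveD[OF g])
    show ?thesis
    proof (cases "k = 2")
      case k: True
      have "2 powr - r * g w \<le> 2 powr - (dp_score t winB v - dp_score t winA v) * g w"
        using r[OF True] gw by (intro mult_right_mono) auto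
      also have "\<dots> \<le> two_weight g y"
        unfolding y using two_weight_ge[OF g 1(2)] k by (simp add: k_def)
      finally show ?thesis using True k by simp
    next
      case k: False
      have "- r \<le> 1" using r[OF True] window_exchange_ge[OF t0, of v] by linarith
      then have "2 powr - r \<le> (2::real) powr 1" by (intro powr_mono) auto
      then have "2 powr - r * g w \<le> 2 * g w" using gw by (intro mult_right_mono) auto
      then show ?thesis using True k after by simp
    qed
  qed
  have kn: "k \<le> n" using ones_le_length[of v] 1(5) y by (simp add: k_def)
  \<comment> \<open>Gains and exponents add over windows, so the left side factorises; the first
    factor is then bounded by the summand for \<open>k = ones v\<close>.\<close>
  have "2 powr - exchange_gain f (X @ x) * (1/4096) ^ (d + e)
      = (1/4096) ^ d * (2 powr - r * (2 powr - exchange_gain (\<lambda>z. f (X @ z)) x * (1/4096) ^ e))"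
    by (simp add: X_def r_def powr_add[symmetric] power_add powr_diff powr_minus divide_simps)
  also have "\<dots> \<le> (1/4096) ^ d * (2 powr - r * g w)"
    using e(1) by (intro mult_left_mono) (auto simp: g_def)
  also have "\<dots> \<le> (1/4096) ^ d * (if X = winA then if k = 2 then two_weight g y else 2 * g (after_ones k y)
      else g (after_ones k y))"
    by (intro mult_left_mono key) auto
  also have "\<dots> \<le> window_sum n X g y"
    unfolding window_sum_def d_def using kn
    by (intro member_le_sum[of k "{..n}" "\<lambda>k. (1/4096) ^ nat_dist k (ones X) *
        (if X = winA then if k = 2 then two_weight g y else 2 * g (after_ones k y)
         else g (after_ones k y))"])
       (auto simp: zero_insensitiveD[OF g] two_weight_nonneg[OF g])
  also have "\<dots> = partition_fun n (X @ x) y" by (simp add: X_def g_def)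
  finally have *: "2 powr - exchange_gain f (X @ x) * (1/4096) ^ (d + e) \<le> partition_fun n (X @ x) y" .
  have "dp_score t X v \<le> t * real (min k (ones X)) + real (length X)"
    using dp_score_le[OF t0, of X v] zeros_le_length[of X]
    by (simp add: k_def min.commute)
  then have "dp_score t X v \<le> t * (real k + real (ones X) - real d) / 2 + real (length X)"
    by (simp add: nat_dist_min d_def)
  with e(2) have "dp_score t (X @ x) y \<le> t * (real (ones (X @ x)) + real (ones y) - real (d + e)) / 2 + real (length (X @ x))"
    unfolding split unfolding y by (simp add: k_def field_simps)
  with * show ?case unfolding X by blast
next
  case ("2_1" f)
  then show ?case using short_dp_score_le[of t "[]" y] by simp
next
  case ("2_2" f v)
  then show ?case using short_dp_score_le[of t "[v]" y] by simp
next
  case ("2_3" f v va)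
  then show ?case using short_dp_score_le[of t "[v, va]" y] by simp
next
  case ("2_4" f v va vb)
  then show ?case using short_dp_score_le[of t "[v, va, vb]" y] by simp
qed

section \<open>Averages over binary words\<close>

text \<open>Expectation over a uniform binary word. Recursion on the first letter lets the
  simplifier average over a window of four letters.\<close>

fun word_avg :: "nat \<Rightarrow> (nat list \<Rightarrow> real) \<Rightarrow> real" where
  "word_avg 0 f = f []"
| "word_avg (Suc n) f = (word_avg n (\<lambda>x. f (0 # x)) + word_avg n (\<lambda>x. f (1 # x))) / 2"

lemma binseqs_0: "binseqs 0 = {[]}"
  by (auto simp: binseqs_def)

lemma binseqs_Suc: "binseqs (Suc n) = (Cons 0 ` binseqs n) \<union> (Cons 1 ` binseqs n)"
proof (intro equalityI subsetI)
  fix x assume "x \<in> binseqs (Suc n)"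
  then show "x \<in> (Cons 0 ` binseqs n) \<union> (Cons 1 ` binseqs n)"
    by (cases x) (auto simp: binseqs_def)
qed (auto simp: binseqs_def)

lemma finite_binseqs: "finite (binseqs n)"
  by (induction n) (auto simp: binseqs_0 binseqs_Suc)

lemma word_avg_eq_sum: "word_avg n f = sum f (binseqs n) / 2 ^ n"
proof (induction n arbitrary: f)
  case (Suc n)
  have "sum f (binseqs (Suc n)) = sum f (Cons 0 ` binseqs n) + sum f (Cons 1 ` binseqs n)"
    unfolding binseqs_Suc by (rule sum.union_disjoint) (auto simp: finite_binseqs)
  also have "\<dots> = (\<Sum>x\<in>binseqs n. f (0 # x)) + (\<Sum>x\<in>binseqs n. f (1 # x))"
    by (simp add: sum.reindex)
  finally have "sum f (binseqs (Suc n)) = \<dots>" .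
  then show ?case unfolding word_avg.simps Suc by (simp add: field_simps)
qed (simp add: binseqs_0)

lemma card_binseqs: "card (binseqs n) = 2 ^ n"
proof (induction n)
  case (Suc n)
  have "card (binseqs (Suc n)) = card (Cons (0::nat) ` binseqs n) + card (Cons (1::nat) ` binseqs n)"
    unfolding binseqs_Suc by (rule card_Un_disjoint) (auto simp: finite_binseqs)
  then show ?case using Suc by (simp add: card_image)
qed (simp add: binseqs_0)

lemma word_avg_const [simp]: "word_avg n (\<lambda>x. c) = c"
  by (simp add: word_avg_eq_sum card_binseqs)

lemma word_avg_add: "word_avg n (\<lambda>x. f x + g x) = word_avg n f + word_avg n g"
  by (simp add: word_avg_eq_sum sum.distrib add_divide_distrib)

lemma word_avg_diff: "word_avg n (\<lambda>x. f x - g x) = word_avg n f - word_avg n g"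
  by (simp add: word_avg_eq_sum sum_subtractf diff_divide_distrib)

lemma word_avg_cmult: "word_avg n (\<lambda>x. c * f x) = c * word_avg n f"
  by (simp add: word_avg_eq_sum sum_distrib_left[symmetric])

lemma word_avg_minus: "word_avg n (\<lambda>x. - f x) = - word_avg n f"
  using word_avg_cmult[of n "-1" f] by simp

lemma word_avg_sum: "word_avg n (\<lambda>x. \<Sum>k\<in>A. f k x) = (\<Sum>k\<in>A. word_avg n (f k))"
  unfolding word_avg_eq_sum by (subst sum.swap) (simp add: sum_divide_distrib)

lemma word_avg_mono: "(\<And>x. x \<in> binseqs n \<Longrightarrow> f x \<le> g x) \<Longrightarrow> word_avg n f \<le> word_avg n g"
  by (simp add: word_avg_eq_sum divide_right_mono sum_mono)

lemma word_avg_cong: "(\<And>x. x \<in> binseqs n \<Longrightarrow> f x = g x) \<Longrightarrow> word_avg n f = word_avg n g"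
  by (simp add: word_avg_eq_sum cong: sum.cong)

lemma word_avg_swap: "word_avg n (\<lambda>x. word_avg m (\<lambda>y. f x y)) = word_avg m (\<lambda>y. word_avg n (\<lambda>x. f x y))"
  unfolding word_avg_eq_sum by (subst sum_divide_distrib[symmetric], subst sum.swap)
    (simp add: sum_divide_distrib mult.commute)

lemma expectation_binseqs:
  "measure_pmf.expectation (pmf_of_set (binseqs n \<times> binseqs n)) f = word_avg n (\<lambda>x. word_avg n (\<lambda>y. f (x, y)))"
proof -
  have "binseqs n \<noteq> {}" using card_binseqs[of n] by force
  then have "measure_pmf.expectation (pmf_of_set (binseqs n \<times> binseqs n)) f
      = sum f (binseqs n \<times> binseqs n) / real (card (binseqs n \<times> binseqs n))"
    by (intro integral_pmf_of_set) (auto simp: finite_binseqs)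
  also have "sum f (binseqs n \<times> binseqs n) = (\<Sum>x\<in>binseqs n. \<Sum>y\<in>binseqs n. f (x, y))"
    by (simp add: sum.cartesian_product)
  finally show ?thesis
    by (simp add: word_avg_eq_sum card_cartesian_product card_binseqs sum_divide_distrib)
qed

text \<open>Second moment of a binomial variable about \<open>c\<close>; the free centre absorbs a
  leading 1 in the induction.\<close>

lemma word_avg_ones_square: "word_avg n (\<lambda>x. (c - real (ones x))\<^sup>2) = (c - real n / 2)\<^sup>2 + real n / 4"
proof (induction n arbitrary: c)
  case (Suc n)
  show ?case using Suc[of c] Suc[of "c - 1"]
    by (simp add: algebra_simps power2_eq_square) (simp add: field_simps)
qed simp

lemma word_avg_ones_diff_square: "word_avg n (\<lambda>x. word_avg n (\<lambda>y. (real (ones x) - real (ones y))\<^sup>2)) = real n / 2"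
proof -
  have "word_avg n (\<lambda>x. (real (ones x) - real n / 2)\<^sup>2) = real n / 4"
    using word_avg_ones_square[of n "real n / 2"] by (simp add: power2_commute)
  then show ?thesis by (simp add: word_avg_ones_square word_avg_add)
qed

section \<open>The average of the partition function\<close>

text \<open>Given its length, what follows the \<open>k\<close>-th one of a random word is again
  uniform. As the length is random, the bound \<open>H\<close> has to be uniform in the
  length.\<close>

lemma word_avg_after_ones_le:
  assumes "\<And>n. word_avg n f \<le> H"
  shows "word_avg n (\<lambda>y. f (after_ones k y)) \<le> H"
proof (induction n arbitrary: k)
  case 0
  then show ?case using assms[of 0] by (cases k) auto
next
  case (Suc n)
  show ?case
  proof (cases k)
    case 0
    then show ?thesis using assms[of "Suc n"] by simp
  next
    case (Suc k')
    then show ?thesis using Suc.IH[of "Suc k'"] Suc.IH[of k'] by simp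
  qed
qed

lemma word_avg_nonneg: "(\<And>x. 0 \<le> f x) \<Longrightarrow> 0 \<le> word_avg n f"
  by (simp add: word_avg_eq_sum sum_nonneg)

text \<open>The surplus over \<open>f\<close> occurs with probability 1/4, and \<open>f\<close>
  ignores the two zeros that cause it; hence 1 + 1/4.\<close>

lemma word_avg_run_weight_le:
  assumes f: "zero_insensitive f" and H: "\<And>n. word_avg n f \<le> H"
  shows "word_avg n (run_weight f) \<le> 5/4 * H"
proof -
  have H0: "0 \<le> H" using H[of 0] zero_insensitiveD(1)[OF f] by (metis order_trans word_avg.simps(1))
  have eq: "run_weight f = (\<lambda>y. f y + (if take 2 y = [0, 0] then f y else 0))"
    by (auto simp: run_weight_def)
  have "word_avg n (\<lambda>y. if take 2 y = [0, 0] then f y else 0) \<le> 1/4 * H"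
  proof -
    consider "n = 0" | "n = 1" | m where "n = Suc (Suc m)" by (metis One_nat_def not0_implies_Suc)
    then show ?thesis
    proof cases
      case 3
      then show ?thesis using H[of m] by (simp add: zero_insensitiveD[OF f])
    qed (use H0 in auto)
  qed
  then show ?thesis using H[of n] unfolding eq word_avg_add by simp
qed

text \<open>The inner run is nonempty with probability 1/2, which gives the factor (1/2 + 1) / 2 =
  3/4, and 3/4 times 5/4 is 15/16. That this is below 1 is the source of the positive mean
  gain.\<close>

lemma word_avg_two_weight_le:
  assumes f: "zero_insensitive f" and H: "\<And>n. word_avg n f \<le> H"
  shows "word_avg n (two_weight f) \<le> 15/16 * H"
proof -
  have H0: "0 \<le> H" using H[of 0] zero_insensitiveD(1)[OF f] by (metis order_trans word_avg.simps(1))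
  note run = word_avg_run_weight_le[OF f H]
  have gap: "word_avg n (gap_weight f) \<le> 15/16 * H" for n
  proof (cases n)
    case (Suc m)
    have "word_avg m (\<lambda>y. 1/2 * run_weight f (after_ones 1 y)) \<le> 1/2 * (5/4 * H)"
      unfolding word_avg_cmult using word_avg_after_ones_le[OF run, of m 1] by simp
    then show ?thesis using run[of m] Suc by simp
  qed (use H0 in simp)
  show ?thesis
  proof (induction n)
    case (Suc n)
    then show ?case using gap[of n] by simp
  qed (use H0 in simp)
qed

text \<open>Two geometric series with ratio 1/4096, each at most 1/4095.\<close>

lemma sum_nat_dist_le:
  "(\<Sum>k\<in>{..n} - {m}. (1/4096::real) ^ nat_dist k m) \<le> 1/2000"
proof -
  have below: "(\<Sum>k<m. (1/4096::real) ^ (m - k)) \<le> 1/4095"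
    by (induction m) (simp_all add: Suc_diff_le sum_divide_distrib[symmetric] sum.lessThan_Suc)
  have above: "(\<Sum>k\<in>{m<..m+p}. (1/4096::real) ^ (k - m)) \<le> 1/4095" for p
  proof -
    have "(\<Sum>k\<in>{m<..m+p}. (1/4096::real) ^ (k - m)) = (\<Sum>k<p. (1/4096) ^ (p - k))"
      by (rule sum.reindex_bij_witness[of _ "\<lambda>k. m + p - k" "\<lambda>k. m + p - k"]) auto
    also have "\<dots> \<le> 1/4095"
      by (induction p) (simp_all add: Suc_diff_le sum_divide_distrib[symmetric] sum.lessThan_Suc)
    finally show ?thesis .
  qed
  have "(\<Sum>k\<in>{..n} - {m}. (1/4096::real) ^ nat_dist k m)
      \<le> (\<Sum>k\<in>{..<m} \<union> {m<..m+n}. (1/4096::real) ^ nat_dist k m)"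
    by (rule sum_mono2) auto
  also have "\<dots> = (\<Sum>k<m. (1/4096::real) ^ nat_dist k m) + (\<Sum>k\<in>{m<..m+n}. (1/4096::real) ^ nat_dist k m)"
    by (rule sum.union_disjoint) auto
  also have "\<dots> = (\<Sum>k<m. (1/4096::real) ^ (m - k)) + (\<Sum>k\<in>{m<..m+n}. (1/4096::real) ^ (k - m))"
    by (simp add: nat_dist_def)
  also have "\<dots> \<le> 1/2000" using below above[of n] by simp
  finally show ?thesis .
qed

text \<open>Main term plus the error 1/2000 of the terms with a wrong number of ones, doubled for
  \<open>winA\<close> because of the factor 2 there.\<close>

definition window_rate :: "nat list \<Rightarrow> real" where
  "window_rate X = (if X = winA then 15/16 + 1/1000 else 1 + 1/2000)"

lemma window_rate_pos: "0 < window_rate X"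
  by (simp add: window_rate_def)

lemma word_avg_window_sum_le:
  assumes f: "zero_insensitive f" and H: "\<And>n. word_avg n f \<le> H"
  shows "word_avg j (window_sum n X f) \<le> window_rate X * H"
proof -
  have H0: "0 \<le> H" using H[of 0] zero_insensitiveD(1)[OF f] by (metis order_trans word_avg.simps(1))
  define m where "m = ones X"
  \<comment> \<open>\<open>q\<close> bounds the term \<open>k = m\<close> and \<open>u\<close> the
    others; for \<open>winA\<close> the former is \<open>k = 2\<close>, where
    \<open>two_weight\<close> applies.\<close>
  define u where "u = (if X = winA then 2 else (1::real))"
  define q where "q = (if X = winA then 15/16 else (1::real))"
  have "word_avg j (window_sum n X f) = (\<Sum>k\<le>n. (1/4096) ^ nat_dist k m *
     word_avg j (\<lambda>y. if X = winA then if k = 2 then two_weight f y else 2 * f (after_ones k y)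
      else f (after_ones k y)))"
    unfolding window_sum_def m_def by (simp only: word_avg_sum word_avg_cmult)
  also have "\<dots> \<le> (\<Sum>k\<le>n. (1/4096) ^ nat_dist k m * ((if k = m then q else u) * H))"
  proof (intro sum_mono mult_left_mono)
    fix k
    show "word_avg j (\<lambda>y. if X = winA then if k = 2 then two_weight f y else 2 * f (after_ones k y)
      else f (after_ones k y)) \<le> (if k = m then q else u) * H"
      using word_avg_after_ones_le[OF H, of j k] word_avg_two_weight_le[OF f H, of j]
      by (auto simp: m_def q_def u_def word_avg_cmult)
  qed auto
  also have "\<dots> = (\<Sum>k\<in>{..n} - {m}. (1/4096) ^ nat_dist k m * (u * H))
      + (\<Sum>k\<in>{..n} \<inter> {m}. (1/4096) ^ nat_dist k m * (q * H))"
    by (subst sum.Int_Diff[of _ _ "{m}"]) (auto intro!: sum.cong)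
  also have "\<dots> \<le> 1/2000 * (u * H) + q * H"
  proof (rule add_mono)
    show "(\<Sum>k\<in>{..n} - {m}. (1/4096) ^ nat_dist k m * (u * H)) \<le> 1/2000 * (u * H)"
      unfolding sum_distrib_right[symmetric] using H0 sum_nat_dist_le[of m n]
      by (intro mult_right_mono) (auto simp: u_def)
    show "(\<Sum>k\<in>{..n} \<inter> {m}. (1/4096) ^ nat_dist k m * (q * H)) \<le> q * H"
      using H0 by (cases "m \<le> n") (auto simp: q_def nat_dist_def)
  qed
  also have "\<dots> = window_rate X * H" by (simp add: u_def q_def window_rate_def algebra_simps)
  finally show ?thesis .
qed

fun rate :: "nat list \<Rightarrow> real" where
  "rate (a # b # c # d # x) = window_rate [a, b, c, d] * rate x"
| "rate x = 1"

lemma rate_pos: "0 < rate x"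
  by (induction x rule: rate.induct) (auto simp: window_rate_pos)

lemma word_avg_partition_fun_le: "word_avg j (partition_fun n x) \<le> rate x"
proof (induction x arbitrary: j rule: rate.induct)
  case (1 a b c d x)
  show ?case using word_avg_window_sum_le[OF zero_insensitive_partition_fun 1] by simp
qed auto

lemma mod4_induct [case_names less step]:
  assumes "\<And>n. n < 4 \<Longrightarrow> P n" and "\<And>n. P n \<Longrightarrow> P (Suc (Suc (Suc (Suc n))))"
  shows "P (n::nat)"
proof (induction n rule: less_induct)
  case (less n)
  show ?case
  proof (cases "n < 4")
    case False
    then have "n = Suc (Suc (Suc (Suc (n - 4))))" by simp
    then show ?thesis using assms(2)[OF less[of "n - 4"]] False by simp
  qed (rule assms(1))
qed

lemma less4_cases: "n < 4 \<Longrightarrow> n = 0 \<or> n = Suc 0 \<or> n = Suc (Suc 0) \<or> n = Suc (Suc (Suc 0))"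
  by auto

text \<open>A window is \<open>winA\<close> with probability 1/16, so by
  \<open>ln z \<le> z - 1\<close> it contributes at most (-1/16 + 1/1000)/16 + (15/16)/2000 =
  -0.003375, below -1/400.\<close>

lemma word_avg_ln_rate_le: "word_avg n (\<lambda>x. ln (rate x)) \<le> - (real (n div 4) / 400)"
proof (induction n rule: mod4_induct)
  case (less n)
  then show ?case by (auto dest!: less4_cases)
next
  case (step n)
  have ln: "ln (window_rate X * rate x) = ln (window_rate X) + ln (rate x)" for X x
    using window_rate_pos[of X] rate_pos[of x] by (simp add: ln_mult)
  have A: "ln (window_rate winA) \<le> - 1/16 + 1/1000"
    using ln_le_minus_one[OF window_rate_pos, of winA] by (simp add: window_rate_def)
  define L where "L = ln (1 + 1/2000::real)"
  have L: "L \<le> 1/2000" unfolding L_def by (rule order_trans[OF ln_le_minus_one]) auto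
  have "X \<noteq> winA \<Longrightarrow> ln (window_rate X) = L" for X
    by (simp add: window_rate_def L_def)
  then have B: "ln (window_rate [a, b, c, d]) = (if [a, b, c, d] = winA then ln (window_rate winA) else L)" for a b c d
    by simp
  show ?case using step A L unfolding word_avg.simps rate.simps ln word_avg_add word_avg_const B
    by (simp add: winA_def add_divide_distrib)
qed

section \<open>The test statistic\<close>

fun window_stat :: "nat list \<Rightarrow> real" where
  "window_stat (a # b # c # d # x) =
     of_bool ([a, b, c, d] = winB) - of_bool ([a, b, c, d] = winA) + window_stat x"
| "window_stat x = 0"

lemma word_avg_window_stat: "word_avg n window_stat = 0"
proof (induction n rule: mod4_induct)
  case (less n)
  then show ?case by (auto dest!: less4_cases)
next
  case (step n)
  then show ?case by (simp add: winA_def winB_def word_avg_add word_avg_diff)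
qed

text \<open>The windows are independent and centred, each with variance 2/16.\<close>

lemma word_avg_window_stat_square: "word_avg n (\<lambda>x. (window_stat x)\<^sup>2) = real (n div 4) / 8"
proof (induction n rule: mod4_induct)
  case (less n)
  then show ?case by (auto dest!: less4_cases)
next
  case (step n)
  have "word_avg n (\<lambda>x. (c + window_stat x)\<^sup>2) = c\<^sup>2 + word_avg n (\<lambda>x. (window_stat x)\<^sup>2)" for c
    by (simp add: power2_sum word_avg_add word_avg_cmult word_avg_window_stat)
  from this[of 1] this[of "-1"] show ?case using step
    by (simp add: winA_def winB_def add_divide_distrib)
qed

text \<open>Words with \<open>winB\<close> at a given window are paired with the words having
  \<open>winA\<close> there and the same letters elsewhere. Both occur equally often, so the
  covariance becomes a mean gain.\<close>

lemma word_avg_window_stat_mult: "word_avg n (\<lambda>x. window_stat x * f x) = word_avg n (exchange_gain f)"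
proof (induction n arbitrary: f rule: mod4_induct)
  case (less n)
  then show ?case by (auto dest!: less4_cases)
next
  case (step n)
  show ?case unfolding word_avg.simps window_stat.simps exchange_gain.simps distrib_right word_avg_add step
    by (simp add: winA_def winB_def word_avg_diff word_avg_minus add_divide_distrib diff_divide_distrib)
qed

section \<open>Variance\<close>

text \<open>The logarithm of the pointwise bound on the partition function, in a form linear in
  \<open>partition_fun n x y\<close> so that it can be averaged over \<open>y\<close>. The 12 is the
  binary logarithm of 4096.\<close>

lemma exchange_gain_ge:
  assumes t: "t \<ge> 2" and x: "x \<in> binseqs n" and y: "y \<in> binseqs n"
  shows "1 - ln (rate x) - partition_fun n x y / rate x
       - 12 * ln 2 * (\<bar>real (ones x) - real (ones y)\<bar> + 2 * real n / t)
     \<le> ln 2 * exchange_gain (\<lambda>z. dp_score t z y) x"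
proof -
  have t0: "t \<ge> 0" using t by simp
  have len: "length x = n" "length y = n" using x y by (auto simp: binseqs_def)
  define G where "G = exchange_gain (\<lambda>z. dp_score t z y) x"
  define F where "F = partition_fun n x y"
  define D where "D = \<bar>real (ones x) - real (ones y)\<bar>"
  obtain e where e: "2 powr - G * (1/4096) ^ e \<le> F"
    "dp_score t x y \<le> t * (real (ones x) + real (ones y) - real e) / 2 + real n"
    using partition_fun_ge[OF t, of 0 y "\<lambda>z. dp_score t z y" x n] len by (auto simp: G_def F_def)
  have "real (min (ones x) (ones y)) = (real (ones x) + real (ones y) - D) / 2"
    by (auto simp: D_def min_def)
  \<comment> \<open>Aligning ones alone already earns \<open>t * min (ones x) (ones y)\<close>; an
    optimal alignment earns at least that much, which bounds \<open>e\<close>.\<close>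
  then have "t * ((real (ones x) + real (ones y) - D) / 2)
      \<le> t * (real (ones x) + real (ones y) - real e) / 2 + real n"
    using e(2) dp_score_ge[OF t0, of x y] by (metis order_trans)
  then have "real e \<le> D + 2 * real n / t" using t by (simp add: field_simps)
  then have "12 * ln 2 * real e \<le> 12 * ln 2 * (D + 2 * real n / t)" by (intro mult_left_mono) auto
  moreover have "- (ln 2 * G) - 12 * ln 2 * real e \<le> ln F"
  proof -
    have "ln (2 powr - G * (1/4096) ^ e) \<le> ln F" using e(1) by (intro ln_mono) auto
    also have "ln (2 powr - G * (1/4096) ^ e) = - (G * ln 2) - real e * ln (2 ^ 12)"
      by (subst ln_mult) (simp_all add: ln_realpow ln_div ln_powr)
    also have "ln (2 ^ 12 :: real) = 12 * ln 2" by (subst ln_realpow) simp_all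
    finally show ?thesis by (simp add: algebra_simps)
  qed
  \<comment> \<open>Tangent of the logarithm at \<open>rate x\<close>, which is an upper bound for
    the mean of \<open>F\<close> over \<open>y\<close>.\<close>
  moreover have "ln F \<le> ln (rate x) + F / rate x - 1"
  proof -
    have "0 < 2 powr - G * (1/4096::real) ^ e" by simp
    then have "0 < F" using e(1) by linarith
    then have "ln (F / rate x) = ln F - ln (rate x)" using rate_pos[of x] by (simp add: ln_div)
    moreover have "ln (F / rate x) \<le> F / rate x - 1"
      using \<open>0 < F\<close> rate_pos[of x] by (intro ln_le_minus_one) simp
    ultimately show ?thesis by linarith
  qed
  ultimately show ?thesis unfolding G_def[symmetric] F_def[symmetric] D_def[symmetric] by linarith
qed

text \<open>The rate yields n/1600 up to a constant. The mean difference of the numbers of ones and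
  the term 24 n/t each cost n/12800, the latter by \<open>t \<ge> 307200\<close>; more than n/3200
  remains.\<close>

lemma word_avg_exchange_gain_ge:
  assumes t: "t \<ge> 307200"
  shows "real n / 3200 - 230401 \<le> word_avg n (\<lambda>x. word_avg n (\<lambda>y. exchange_gain (\<lambda>z. dp_score t z y) x))"
proof -
  define D where "D x y = \<bar>real (ones x) - real (ones y)\<bar>" for x y
  define E where "E = word_avg n (\<lambda>x. word_avg n (\<lambda>y. D x y))"
  define G where "G = word_avg n (\<lambda>x. word_avg n (\<lambda>y. exchange_gain (\<lambda>z. dp_score t z y) x))"
  \<comment> \<open>The difference is of order \<surd>n in mean. Completing a square trades it for a
    small multiple of its second moment n/2 and a constant.\<close>
  have "D x y \<le> (real (ones x) - real (ones y))\<^sup>2 / 76800 + 19200" for x y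
  proof -
    have "0 \<le> (D x y - 38400)\<^sup>2" by simp
    moreover have "(D x y)\<^sup>2 = (real (ones x) - real (ones y))\<^sup>2" by (simp add: D_def)
    ultimately show ?thesis by (simp add: power2_diff[of "D x y"] field_simps)
  qed
  then have "E \<le> word_avg n (\<lambda>x. word_avg n (\<lambda>y. 1 / 76800 * (real (ones x) - real (ones y))\<^sup>2 + 19200))"
    unfolding E_def by (intro word_avg_mono) simp
  also have "\<dots> = real n / 153600 + 19200"
    unfolding word_avg_add word_avg_cmult word_avg_const word_avg_ones_diff_square by simp
  finally have E: "E \<le> real n / 153600 + 19200" .
  have lower: "word_avg n (\<lambda>y. 1 - ln (rate x) - 1 / rate x * partition_fun n x y
       - 12 * ln 2 * (D x y + 2 * real n / t))
     \<le> word_avg n (\<lambda>y. ln 2 * exchange_gain (\<lambda>z. dp_score t z y) x)" if "x \<in> binseqs n" for x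
    using exchange_gain_ge[OF _ that, of t] t by (intro word_avg_mono) (auto simp: D_def)
  have upper: "1 / rate x * word_avg n (partition_fun n x) \<le> 1" for x
    using word_avg_partition_fun_le[of n n x] rate_pos[of x] by simp
  have "- ln (rate x) - 12 * ln 2 * (word_avg n (D x) + 2 * real n / t)
     \<le> ln 2 * word_avg n (\<lambda>y. exchange_gain (\<lambda>z. dp_score t z y) x)" if "x \<in> binseqs n" for x
    using lower[OF that] upper[of x] unfolding word_avg_diff word_avg_cmult word_avg_add word_avg_const by linarith
  then have "word_avg n (\<lambda>x. - ln (rate x) - 12 * ln 2 * (word_avg n (D x) + 2 * real n / t)) \<le> ln 2 * G"
    unfolding G_def word_avg_cmult[of n "ln 2", symmetric] by (intro word_avg_mono) (simp add: word_avg_cmult)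
  then have *: "- word_avg n (\<lambda>x. ln (rate x)) - 12 * ln 2 * (E + 2 * real n / t) \<le> ln 2 * G"
    unfolding word_avg_diff word_avg_minus word_avg_cmult word_avg_add word_avg_const E_def .
  \<comment> \<open>Since \<open>ln 2 \<le> 1\<close>, the main term may be multiplied by
    \<open>ln 2\<close>, and this common factor then cancels.\<close>
  have "ln 2 * (real (n div 4) / 400) \<le> 1 * (real (n div 4) / 400)"
    using ln_le_minus_one[of 2] by (intro mult_right_mono) auto
  moreover have "ln 2 * (real (n div 4) / 400 - 12 * (E + 2 * real n / t))
      = ln 2 * (real (n div 4) / 400) - 12 * ln 2 * (E + 2 * real n / t)"
    by (simp add: right_diff_distrib)
  ultimately have "ln 2 * (real (n div 4) / 400 - 12 * (E + 2 * real n / t)) \<le> ln 2 * G"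
    using * word_avg_ln_rate_le[of n] by linarith
  then have "real (n div 4) / 400 - 12 * (E + 2 * real n / t) \<le> G" by simp
  moreover have "real n / t \<le> real n / 307200" using t by (intro divide_left_mono) auto
  moreover have "real n \<le> 4 * real (n div 4) + 3" by linarith
  ultimately show ?thesis using E unfolding G_def[symmetric] by simp
qed

lemma word_avg2_window_stat_mult:
  "word_avg n (\<lambda>x. word_avg n (\<lambda>y. window_stat x * dp_score t x y))
     = word_avg n (\<lambda>x. word_avg n (\<lambda>y. exchange_gain (\<lambda>z. dp_score t z y) x))"
  using word_avg_swap[of n n "\<lambda>x y. window_stat x * dp_score t x y"]
    word_avg_swap[of n n "\<lambda>x y. exchange_gain (\<lambda>z. dp_score t z y) x"]
  by (simp add: word_avg_window_stat_mult)

text \<open>Cauchy-Schwarz in linear form: expand the square of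
  \<open>dp_score t x y - \<mu> - W/100\<close>. The factor 1/100 is the ratio of the covariance
  bound n/3200 to the variance n/32 of \<open>W\<close>, to leading order. Since \<open>W\<close>
  has mean 0, any \<open>\<mu>\<close> may be used.\<close>

lemma variance_ge_linear:
  assumes t: "t \<ge> 307200"
  shows "real n / 320000 - 4609 \<le> word_avg n (\<lambda>x. word_avg n (\<lambda>y. (dp_score t x y - \<mu>)\<^sup>2))"
proof -
  let ?W = window_stat
  have "1/50 * (?W x * dp_score t x y) - 1/50 * \<mu> * ?W x - 1/10000 * (?W x)\<^sup>2 \<le> (dp_score t x y - \<mu>)\<^sup>2" for x y
  proof -
    have "0 \<le> (dp_score t x y - \<mu> - 1/100 * ?W x)\<^sup>2" by simp
    then show ?thesis by (simp add: power2_eq_square algebra_simps)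
  qed
  then have "word_avg n (\<lambda>x. word_avg n (\<lambda>y. 1/50 * (?W x * dp_score t x y) - 1/50 * \<mu> * ?W x - 1/10000 * (?W x)\<^sup>2))
     \<le> word_avg n (\<lambda>x. word_avg n (\<lambda>y. (dp_score t x y - \<mu>)\<^sup>2))"
    by (intro word_avg_mono)
  moreover have "word_avg n (\<lambda>x. word_avg n (\<lambda>y. 1/50 * (?W x * dp_score t x y) - 1/50 * \<mu> * ?W x - 1/10000 * (?W x)\<^sup>2))
      = 1/50 * word_avg n (\<lambda>x. word_avg n (\<lambda>y. ?W x * dp_score t x y)) - 1/10000 * (real (n div 4) / 8)"
    unfolding word_avg_diff word_avg_cmult[of n "1/50"] word_avg_const
    by (simp only: word_avg_diff word_avg_cmult word_avg_window_stat word_avg_window_stat_square)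
  moreover have "real (n div 4) \<le> real n / 4" by linarith
  ultimately show ?thesis
    using word_avg_exchange_gain_ge[OF t, of n]
    unfolding word_avg2_window_stat_mult by simp
qed

section \<open>Small n and the choice of the constant\<close>

lemma word_avg_ge_single:
  assumes "\<And>x. 0 \<le> f x" "x \<in> binseqs n"
  shows "f x / 2 ^ n \<le> word_avg n f"
  unfolding word_avg_eq_sum using assms
  by (intro divide_right_mono member_le_sum) (auto simp: finite_binseqs)

text \<open>Covers the small n for which the linear bound is negative. The scores of the all-zero
  pair and the all-one pair differ by at least 1, so one of them is at least 1/2 away from
  \<open>\<mu>\<close>; each pair has probability \<open>1 / 4 ^ n\<close>.\<close>

lemma variance_ge_const:
  assumes t: "t \<ge> 2" and n: "n \<ge> 1"
  shows "1 / 4 ^ Suc n \<le> word_avg n (\<lambda>x. word_avg n (\<lambda>y. (dp_score t x y - \<mu>)\<^sup>2))"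
proof -
  define V where "V = word_avg n (\<lambda>x. word_avg n (\<lambda>y. (dp_score t x y - \<mu>)\<^sup>2))"
  have t0: "t \<ge> 0" using t by simp
  have V: "(dp_score t x y - \<mu>)\<^sup>2 / 4 ^ n \<le> V" if "x \<in> binseqs n" "y \<in> binseqs n" for x y
  proof -
    have "(dp_score t x y - \<mu>)\<^sup>2 / 2 ^ n \<le> word_avg n (\<lambda>y. (dp_score t x y - \<mu>)\<^sup>2)"
      by (rule word_avg_ge_single) (use that in auto)
    then have "(dp_score t x y - \<mu>)\<^sup>2 / 2 ^ n / 2 ^ n \<le> word_avg n (\<lambda>y. (dp_score t x y - \<mu>)\<^sup>2) / 2 ^ n"
      by (intro divide_right_mono) auto
    also have "\<dots> \<le> V" unfolding V_def
      by (rule word_avg_ge_single) (use that in \<open>auto intro!: word_avg_nonneg\<close>)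
    finally show ?thesis by (simp add: power_mult_distrib[symmetric])
  qed
  define z where "z = replicate n (0::nat)"
  define w where "w = replicate n (1::nat)"
  have mem: "z \<in> binseqs n" "w \<in> binseqs n" by (auto simp: z_def w_def binseqs_def)
  have "dp_score t z z \<le> real n" using dp_score_le[OF t0, of z z] by (simp add: z_def)
  moreover have "ones w = n" unfolding w_def by (induction n) auto
  then have "t * real n \<le> dp_score t w w" using dp_score_ge[OF t0, of w w] by simp
  moreover have "2 * real n \<le> t * real n" using t by (intro mult_right_mono) auto
  ultimately have d: "1 \<le> dp_score t w w - dp_score t z z" using n by linarith
  have "1 / 4 \<le> max ((dp_score t z z - \<mu>)\<^sup>2) ((dp_score t w w - \<mu>)\<^sup>2)"
  proof -
    have "1/2 \<le> \<bar>dp_score t z z - \<mu>\<bar> \<or> 1/2 \<le> \<bar>dp_score t w w - \<mu>\<bar>" using d by linarith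
    then have "(1/2)\<^sup>2 \<le> (dp_score t z z - \<mu>)\<^sup>2 \<or> (1/2)\<^sup>2 \<le> (dp_score t w w - \<mu>)\<^sup>2"
      by (metis abs_le_square_iff abs_of_nonneg zero_le_divide_1_iff zero_le_numeral)
    then show ?thesis by (auto simp: power2_eq_square le_max_iff_disj)
  qed
  then have "1 / 4 / 4 ^ n \<le> max ((dp_score t z z - \<mu>)\<^sup>2) ((dp_score t w w - \<mu>)\<^sup>2) / 4 ^ n"
    by (intro divide_right_mono) auto
  also have "\<dots> \<le> V" using V[OF mem(1) mem(1)] V[OF mem(2) mem(2)] by (simp add: max_def)
  finally show ?thesis by (simp add: V_def)
qed

text \<open>The constant is chosen before \<open>v\<close>, since in the theorem it must not depend
  on the scoring function.\<close>

lemma linear_lower_bound: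
  fixes a b :: real
  assumes "a > 0"
  shows "\<exists>c>0. \<forall>v. (\<forall>n. a * real n - b \<le> v n) \<and> (\<forall>n\<ge>1. 1 / 4 ^ Suc n \<le> v n) \<and> (0 \<le> v 0)
    \<longrightarrow> (\<forall>n. c * real n \<le> v n)"
proof -
  \<comment> \<open>From \<open>N\<close> on, \<open>b\<close> is at most half of
    \<open>a * n\<close>; up to \<open>N\<close> the exponential bound at \<open>N\<close>
    suffices.\<close>
  define N where "N = max 1 (nat \<lceil>2 * b / a\<rceil>)"
  have N: "N \<ge> 1" "2 * b / a \<le> real N" unfolding N_def by linarith+
  define c where "c = min (a / 2) (1 / 4 ^ Suc N / real N)"
  have "c > 0" using assms N by (simp add: c_def)
  moreover have "c * real n \<le> v n"
    if lin: "\<And>n. a * real n - b \<le> v n" and pos: "\<And>n. n \<ge> 1 \<Longrightarrow> 1 / 4 ^ Suc n \<le> v n"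
      and "0 \<le> v 0" for v :: "nat \<Rightarrow> real" and n
  proof -
    consider "n = 0" | "1 \<le> n" "n \<le> N" | "N \<le> n" by linarith
    then show ?thesis
    proof cases
      case 1
      then show ?thesis using that by simp
    next
      case 2
      have "c * real n \<le> 1 / 4 ^ Suc N / real N * real N"
        using 2 N \<open>c > 0\<close> by (intro mult_mono) (auto simp: c_def)
      also have "\<dots> = 1 / 4 ^ Suc N" using N by simp
      also have "\<dots> \<le> 1 / 4 ^ Suc n" using 2 by (intro divide_left_mono power_increasing) auto
      finally show ?thesis using pos[of n] 2 by linarith
    next
      case 3
      then have "2 * b / a \<le> real n" using N by linarith
      then have "b \<le> a / 2 * real n" using assms by (simp add: field_simps)
      moreover have "c * real n \<le> a / 2 * real n" by (intro mult_right_mono) (auto simp: c_def)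
      ultimately show ?thesis using lin[of n] by linarith
    qed
  qed
  ultimately show ?thesis by blast
qed

theorem theorem2p1:
  shows "\<exists>c::real > 0. \<exists>s0::real > 0. \<forall>s :: nat \<Rightarrow> nat \<Rightarrow> real.
           s 1 0 = 0 \<and> s 0 1 = 0 \<and> s 0 0 = 1 \<and> s 1 1 \<ge> s0 \<longrightarrow>
           (\<forall>n::nat. measure_pmf.variance (pmf_of_set (binseqs n \<times> binseqs n))
                        (\<lambda>(x, y). opt_score s n x y) \<ge> c * real n)"
proof -
  obtain c :: real where c: "c > 0"
    "\<And>v. (\<forall>n. 1 / 320000 * real n - 4609 \<le> v n) \<and> (\<forall>n\<ge>1. 1 / 4 ^ Suc n \<le> v n) \<and> (0 \<le> v 0)
      \<Longrightarrow> (\<forall>n. c * real n \<le> v n)"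
    using linear_lower_bound[of "1 / 320000" 4609] by auto
  have "\<forall>n. c * real n \<le> measure_pmf.variance (pmf_of_set (binseqs n \<times> binseqs n))
          (\<lambda>(x, y). opt_score s n x y)"
    if s: "s 1 0 = 0 \<and> s 0 1 = 0 \<and> s 0 0 = 1 \<and> s 1 1 \<ge> 307200" for s :: "nat \<Rightarrow> nat \<Rightarrow> real"
  proof (rule c(2), intro conjI allI impI)
    \<comment> \<open>The value of the mean is never computed, as both variance bounds hold for
      every centre \<open>\<mu>\<close>.\<close>
    have var: "\<exists>\<mu>. measure_pmf.variance (pmf_of_set (binseqs n \<times> binseqs n))
          (\<lambda>(x, y). opt_score s n x y) = word_avg n (\<lambda>x. word_avg n (\<lambda>y. (dp_score (s 1 1) x y - \<mu>)\<^sup>2))" for n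
      unfolding expectation_binseqs using s opt_score_eq_dp_score[of s]
      by (intro exI word_avg_cong) (auto intro!: word_avg_cong)
    fix n :: nat
    show "1 / 320000 * real n - 4609 \<le> measure_pmf.variance (pmf_of_set (binseqs n \<times> binseqs n))
          (\<lambda>(x, y). opt_score s n x y)"
      using var[of n] variance_ge_linear[of "s 1 1" n] s by auto
    show "1 / 4 ^ Suc n \<le> measure_pmf.variance (pmf_of_set (binseqs n \<times> binseqs n))
          (\<lambda>(x, y). opt_score s n x y)" if "1 \<le> n"
      using var[of n] variance_ge_const[of "s 1 1" n] s that by auto
    show "0 \<le> measure_pmf.variance (pmf_of_set (binseqs 0 \<times> binseqs 0))
          (\<lambda>(x, y). opt_score s 0 x y)"
      by (simp add: measure_pmf.variance_positive)
  qed
  then show ?thesis using c(1) by (intro exI[of _ c] exI[of _ 307200] conjI) auto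
qed

end
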